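(* Consider the control-affine system $\dot{x}=f(x)+g(x)u$ with $x\in\mathbb{R}^n$, unconstrained input $u\in\mathbb{R}^m$, $f\in\mathbb{R}^n[x]$, $g\in\mathbb{R}^{n\times m}[x]$, and a single candidate control barrier function (CBF) $b\in\mathbb{R}[x]$. Let $a\geq 0$ be an integer, let $p_{10},p_{20}\in\mathbb{R}[x]$ and $p_1,p_2\in\mathbb{R}^m[x]$ be polynomial variables, and let $s_1,s_2\in\mathcal{D}[x]$ be diagonally dominant sum-of-squares (DSOS) polynomial variables, parametrized as $s_i(x)=m^T(x)Q_im(x)$, $p_{i0}(x)=c_{i0}^Tm(x)$, $p_i(x)=c_i^Tm(x)$ for $i=1,2$, where $m(x)\in\mathbb{R}^k[x]$ is a monomial basis vector, $Q_i\in\mathbb{R}^{k\times k}$ is symmetric, $c_{i0}\in\mathbb{R}^k$, and $c_i\in\mathbb{R}^{k\times m}$. Consider the linear program $$\begin{aligned}\min_z\quad & 0\\ \text{s.t.}\quad & Q_i\succeq_{dd}0\quad\text{for } i=1,2,\\ & G_\ell\big((s_1+bp_{10}+L_gb\,p_1)L_fb-s_2-bp_{20}-L_gb\,p_2-(L_fb)^{2a}\big)=0,\end{aligned}$$ where $\ell=\lceil d/2\rceil$ with $d$ the degree of the polynomial argument of $G_\ell$, the matrix equation is element-wise, and the decision variable is $$z=[c_{10}^T\ \ c_{20}^T\ \ \mathrm{col}(c_1)^T\ \ \mathrm{col}(c_2)^T\ \ \mathrm{uTri}(Q_1)^T\ \ \mathrm{uTri}(\tau_1)^T\ \ \mathrm{uTri}(Q_2)^T\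 \ \mathrm{uTri}(\tau_2)^T]^T\in\mathbb{R}^{2k^2+(2m+4)k}.$$ If this linear program has a solution, then $b$ is a CBF.
   Context: $\mathbb{R}[x]$ is the ring of real polynomials in $x=(x_1,\dots,x_n)$; $\mathbb{R}^{m\times n}[x]$ denotes $m\times n$ matrices with entries in $\mathbb{R}[x]$, and $\mathbb{R}^m[x]=\mathbb{R}^{m\times 1}[x]$. The symbol $m$ is the number of inputs, while $m(x)$ is a vector of monomials: a monomial basis vector of degree $\delta$ lists all monomials in $x$ of degree at most $\delta$ and has length $\binom{n+\delta}{n}$. The integer $k$ is the length of $m(x)$. Lie derivatives: $L_fb(x)=\frac{\partial b(x)}{\partial x}f(x)\in\mathbb{R}[x]$ and $L_gb(x)=\frac{\partial b(x)}{\partial x}g(x)$, a vector of $m$ polynomials, treated as a row in products $L_gb(x)u$ and $L_gb(x)p_i(x)$. Diagonal dominance: for symmetric $Q\in\mathbb{R}^{k\times k}$, $Q\succeq_{dd}0$ means $Q_{ii}\geq\sum_{j\neq i}|Q_{ij}|$ for all $i$. In the program it is enforced with a symmetric auxiliary matrix $\tau\in\mathbb{R}^{k\times k}$ (one $\tau_i$ for each $Q_i$) through the linear constraints $-Q_{ii}+\sum_{j\neq i}\tau_{ij}\leq 0$ for all $i$, and $Q_{ij}-\tau_{ij}\leq 0$, $-Q_{ij}-\tau_{ij}\leq 0$ for all $i\neq j$. A polynomial $s$ of degree $2\delta$ is DSOS, written $s\in\mathcal{D}[x]$, if $s(x)=m^T(x)Qm(x)$ for a monomial basis vector $m(x)$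 and a symmetric $Q\succeq_{dd}0$. $\mathrm{col}$ maps a matrix to the column vector formed by concatenating its transposed rows; $\mathrm{uTri}$ maps a symmetric $k\times k$ matrix to the vector of its $\tfrac12(k^2+k)$ upper triangular entries. Gram operation: for a polynomial $e$, $G_\ell(e)$ is a matrix composed of the monomial coefficients of $e$ (depending linearly on those coefficients) such that $e(x)=\mu^T(x)G_\ell(e)\mu(x)$, where $\mu(x)$ is the monomial basis vector of degree $\ell$. Hence $G_\ell(e)=0$ encodes the polynomial identity $e=0$. CBF: $b$ is a CBF if there is an extended class-$\mathcal{K}$ function $\kappa$ such that $\sup_u\{L_fb(x)+L_gb(x)u+\kappa(b(x))\}\geq 0$ for all $x\in\mathbb{R}^n$; the corresponding constraint on the input is $L_gb(x)u\geq-\kappa(b(x))-L_fb(x)$. Inputs are unbounded throughout, and the following criterion from the literature is adopted as the standing characterization: a candidate $b$ satisfies the CBF input constraint (i.e. is a CBF) if and only if there is no $x\in\mathbb{R}^n$ with $b(x)=0$, $L_gb(x)=0$ and $L_fb(x)<0$. *)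

theory Defs
  imports
    "Jordan_Normal_Form.Matrix"
    "HOL-Library.Extended_Real"
    "HOL-Library.Poly_Mapping"
begin

section \<open>Real polynomials in \<open>n\<close> variables\<close>

text \<open>
  A monomial \<open>x\<^sup>\<alpha>\<close> is its exponent function \<open>\<alpha>\<close>, a polynomial its finitely supported family of
  coefficients; \<open>poly_mapping\<close> supplies the ring operations. The ring \<open>\<real>[x\<^sub>0, \<dots>, x\<^sub>n\<^sub>-\<^sub>1]\<close> is the
  subset \<open>poly_ring n\<close>, so that vectors and matrices of polynomials are ordinary \<open>vec\<close> and \<open>mat\<close>
  with carrier dimensions.
\<close>

type_synonym monom = "nat \<Rightarrow>\<^sub>0 nat"
type_synonym rpoly = "monom \<Rightarrow>\<^sub>0 real"

definition poly_ring :: "nat \<Rightarrow> rpoly set" where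
  "poly_ring n = {p. \<forall>\<alpha>\<in>Poly_Mapping.keys p. Poly_Mapping.keys \<alpha> \<subseteq> {..<n}}"

definition monom_degree :: "monom \<Rightarrow> nat" where
  "monom_degree \<alpha> = (\<Sum>i\<in>Poly_Mapping.keys \<alpha>. Poly_Mapping.lookup \<alpha> i)"

text \<open>Total degree; the zero polynomial gets degree 0.\<close>

definition total_degree :: "rpoly \<Rightarrow> nat" where
  "total_degree p = Max (insert 0 (monom_degree ` Poly_Mapping.keys p))"

definition const_poly :: "real \<Rightarrow> rpoly" where
  "const_poly c = Poly_Mapping.single 0 c"

definition eval_poly :: "real vec \<Rightarrow> rpoly \<Rightarrow> real" where
  "eval_poly x p =
     (\<Sum>\<alpha>\<in>Poly_Mapping.keys p. Poly_Mapping.lookup p \<alpha> *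
        (\<Prod>i\<in>Poly_Mapping.keys \<alpha>. (x $ i) ^ Poly_Mapping.lookup \<alpha> i))"

text \<open>
  If \<open>x\<^sub>i\<close> does not occur in \<open>x\<^sup>\<alpha>\<close>, the truncated exponent is harmless because the coefficient is 0.
\<close>

definition partial_deriv :: "nat \<Rightarrow> rpoly \<Rightarrow> rpoly" where
  "partial_deriv i p =
     (\<Sum>\<alpha>\<in>Poly_Mapping.keys p. Poly_Mapping.single (\<alpha> - Poly_Mapping.single i 1)
                     (Poly_Mapping.lookup p \<alpha> * real (Poly_Mapping.lookup \<alpha> i)))"

definition gradient :: "nat \<Rightarrow> rpoly \<Rightarrow> rpoly vec" where
  "gradient n b = vec n (\<lambda>i. partial_deriv i b)"


section \<open>Lie derivatives and control barrier functions\<close>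

definition lie_f :: "rpoly vec \<Rightarrow> rpoly \<Rightarrow> rpoly" where
  "lie_f f b = gradient (dim_vec f) b \<bullet> f"

definition lie_g :: "rpoly mat \<Rightarrow> rpoly \<Rightarrow> rpoly vec" where
  "lie_g g b = transpose_mat g *\<^sub>v gradient (dim_row g) b"

definition ext_class_K :: "(real \<Rightarrow> real) \<Rightarrow> bool" where
  "ext_class_K \<kappa> \<longleftrightarrow> continuous_on UNIV \<kappa> \<and> strict_mono \<kappa> \<and> \<kappa> 0 = 0"

text \<open>
  The state dimension is \<open>dim_vec f\<close>, the input dimension \<open>dim_col g\<close>. The supremum is taken in the
  extended reals since it is infinite wherever \<open>L\<^sub>g b\<close> does not vanish.
\<close>

definition cbf :: "rpoly vec \<Rightarrow> rpoly mat \<Rightarrow> rpoly \<Rightarrow> bool" where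
  "cbf f g b \<longleftrightarrow>
     (\<exists>\<kappa>. ext_class_K \<kappa> \<and>
        (\<forall>x \<in> carrier_vec (dim_vec f).
           0 \<le> (SUP u \<in> carrier_vec (dim_col g).
                  ereal (eval_poly x (lie_f f b) + map_vec (eval_poly x) (lie_g g b) \<bullet> u
                         + \<kappa> (eval_poly x b)))))"

text \<open>
  The criterion adopted as characterisation of control barrier functions for unconstrained inputs.
  For arbitrary polynomial data it does not imply \<open>cbf\<close>: take \<open>f = 0\<close>, \<open>g = 0\<close>, \<open>b = x\<^sub>0\<close>, where
  \<open>cbf\<close> fails at every \<open>x\<close> with \<open>b(x) < 0\<close>. So the two notions are kept apart here.
\<close>

definition cbf_criterion :: "rpoly vec \<Rightarrow> rpoly mat \<Rightarrow> rpoly \<Rightarrow> bool" where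
  "cbf_criterion f g b \<longleftrightarrow>
     \<not> (\<exists>x \<in> carrier_vec (dim_vec f).
          eval_poly x b = 0 \<and>
          map_vec (eval_poly x) (lie_g g b) = 0\<^sub>v (dim_col g) \<and>
          eval_poly x (lie_f f b) < 0)"


section \<open>Monomial bases and Gram matrices\<close>

text \<open>The order in which a basis lists the monomials is left open.\<close>

definition monomial_basis :: "nat \<Rightarrow> nat \<Rightarrow> monom list \<Rightarrow> bool" where
  "monomial_basis n \<delta> \<mu> \<longleftrightarrow>
     distinct \<mu> \<and> set \<mu> = {\<alpha>. Poly_Mapping.keys \<alpha> \<subseteq> {..<n} \<and> monom_degree \<alpha> \<le> \<delta>}"

definition monom_vec :: "monom list \<Rightarrow> rpoly vec" where
  "monom_vec \<mu> = vec_of_list (map (\<lambda>\<alpha>. Poly_Mapping.single \<alpha> 1) \<mu>)"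

definition lin_poly :: "monom list \<Rightarrow> real vec \<Rightarrow> rpoly" where
  "lin_poly \<mu> c = map_vec const_poly c \<bullet> monom_vec \<mu>"

definition lin_poly_vec :: "monom list \<Rightarrow> real mat \<Rightarrow> rpoly vec" where
  "lin_poly_vec \<mu> C = map_mat const_poly (transpose_mat C) *\<^sub>v monom_vec \<mu>"

definition quad_poly :: "monom list \<Rightarrow> real mat \<Rightarrow> rpoly" where
  "quad_poly \<mu> Q = monom_vec \<mu> \<bullet> (map_mat const_poly Q *\<^sub>v monom_vec \<mu>)"

text \<open>
  The Gram matrix of a polynomial is not unique; \<open>gram_operation n l \<mu> G\<close> admits every choice
  \<open>G\<close> that is linear on the polynomials of degree at most \<open>2l\<close>.
\<close>

definition gram_operation :: "nat \<Rightarrow> nat \<Rightarrow> monom list \<Rightarrow> (rpoly \<Rightarrow> real mat) \<Rightarrow> bool" where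
  "gram_operation n l \<mu> G \<longleftrightarrow>
     (let P = {e \<in> poly_ring n. total_degree e \<le> 2 * l} in
        (\<forall>e\<in>P. G e \<in> carrier_mat (length \<mu>) (length \<mu>) \<and> e = quad_poly \<mu> (G e)) \<and>
        (\<forall>e\<in>P. \<forall>e'\<in>P. G (e + e') = G e + G e') \<and>
        (\<forall>e\<in>P. \<forall>c. G (const_poly c * e) = c \<cdot>\<^sub>m G e))"


section \<open>Diagonal dominance\<close>

definition dd_psd :: "real mat \<Rightarrow> bool" where
  "dd_psd Q \<longleftrightarrow>
     (\<forall>i < dim_row Q. (\<Sum>j \<in> {..<dim_row Q} - {i}. \<bar>Q $$ (i, j)\<bar>) \<le> Q $$ (i, i))"

definition dd_constraints :: "real mat \<Rightarrow> real mat \<Rightarrow> bool" where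
  "dd_constraints Q \<tau> \<longleftrightarrow>
     (\<forall>i < dim_row Q. - Q $$ (i, i) + (\<Sum>j \<in> {..<dim_row Q} - {i}. \<tau> $$ (i, j)) \<le> 0) \<and>
     (\<forall>i < dim_row Q. \<forall>j < dim_row Q. i \<noteq> j \<longrightarrow>
        Q $$ (i, j) - \<tau> $$ (i, j) \<le> 0 \<and> - Q $$ (i, j) - \<tau> $$ (i, j) \<le> 0)"

definition sym_mats :: "nat \<Rightarrow> real mat set" where
  "sym_mats k = {A \<in> carrier_mat k k. transpose_mat A = A}"

lemma dd_psd_iff_dd_constraints:
  assumes "Q \<in> sym_mats k"
  shows "dd_psd Q \<longleftrightarrow> (\<exists>\<tau> \<in> sym_mats k. dd_constraints Q \<tau>)"
proof
  have Q: "Q \<in> carrier_mat k k" and sym: "transpose_mat Q = Q"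
    using assms by (simp_all add: sym_mats_def)
  then have dim: "dim_row Q = k" "dim_col Q = k" by simp_all
  assume dd: "dd_psd Q"
  have "transpose_mat (map_mat abs Q) = map_mat abs (transpose_mat Q)"
    by (rule eq_matI) simp_all
  then have "map_mat abs Q \<in> sym_mats k"
    using Q sym by (simp add: sym_mats_def)
  moreover have "(\<Sum>j \<in> {..<k} - {i}. map_mat abs Q $$ (i, j)) =
      (\<Sum>j \<in> {..<k} - {i}. \<bar>Q $$ (i, j)\<bar>)" if "i < k" for i
    using that dim by (intro sum.cong) simp_all
  then have "dd_constraints Q (map_mat abs Q)"
    using dd dim unfolding dd_constraints_def dd_psd_def
    by (simp add: abs_ge_self abs_ge_minus_self)
  ultimately show "\<exists>\<tau> \<in> sym_mats k. dd_constraints Q \<tau>" by blast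
next
  assume "\<exists>\<tau> \<in> sym_mats k. dd_constraints Q \<tau>"
  then obtain \<tau> where \<tau>: "dd_constraints Q \<tau>" by blast
  have "(\<Sum>j \<in> {..<dim_row Q} - {i}. \<bar>Q $$ (i, j)\<bar>) \<le> Q $$ (i, i)" if i: "i < dim_row Q" for i
  proof -
    have "\<bar>Q $$ (i, j)\<bar> \<le> \<tau> $$ (i, j)" if "j \<in> {..<dim_row Q} - {i}" for j
    proof -
      have "Q $$ (i, j) - \<tau> $$ (i, j) \<le> 0" "- Q $$ (i, j) - \<tau> $$ (i, j) \<le> 0"
        using \<tau> i that unfolding dd_constraints_def by blast+
      then show ?thesis by linarith
    qed
    then have "(\<Sum>j \<in> {..<dim_row Q} - {i}. \<bar>Q $$ (i, j)\<bar>) \<le>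
        (\<Sum>j \<in> {..<dim_row Q} - {i}. \<tau> $$ (i, j))"
      by (rule sum_mono)
    moreover have "- Q $$ (i, i) + (\<Sum>j \<in> {..<dim_row Q} - {i}. \<tau> $$ (i, j)) \<le> 0"
      using \<tau> i unfolding dd_constraints_def by blast
    ultimately show ?thesis by linarith
  qed
  then show "dd_psd Q" by (simp add: dd_psd_def)
qed


section \<open>The linear program\<close>

definition row_major :: "'a mat \<Rightarrow> 'a vec" where
  "row_major A = vec_of_list (concat (map (\<lambda>i. list_of_vec (row A i)) [0..<dim_row A]))"

definition u_tri :: "'a mat \<Rightarrow> 'a vec" where
  "u_tri A = vec_of_list (concat (map (\<lambda>i. map (\<lambda>j. A $$ (i, j)) [i..<dim_row A]) [0..<dim_row A]))"

record lp_vars =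
  c10 :: "real vec"
  c20 :: "real vec"
  c1 :: "real mat"
  c2 :: "real mat"
  Q1 :: "real mat"
  \<tau>1 :: "real mat"
  Q2 :: "real mat"
  \<tau>2 :: "real mat"

definition lp_vars_set :: "nat \<Rightarrow> nat \<Rightarrow> lp_vars set" where
  "lp_vars_set k m =
     {v. c10 v \<in> carrier_vec k \<and> c20 v \<in> carrier_vec k \<and>
         c1 v \<in> carrier_mat k m \<and> c2 v \<in> carrier_mat k m \<and>
         Q1 v \<in> sym_mats k \<and> \<tau>1 v \<in> sym_mats k \<and>
         Q2 v \<in> sym_mats k \<and> \<tau>2 v \<in> sym_mats k}"

definition decision_vec :: "lp_vars \<Rightarrow> real vec" where
  "decision_vec v =
     c10 v @\<^sub>v c20 v @\<^sub>v row_major (c1 v) @\<^sub>v row_major (c2 v) @\<^sub>v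
     u_tri (Q1 v) @\<^sub>v u_tri (\<tau>1 v) @\<^sub>v u_tri (Q2 v) @\<^sub>v u_tri (\<tau>2 v)"

definition gram_arg ::
  "rpoly vec \<Rightarrow> rpoly mat \<Rightarrow> rpoly \<Rightarrow> nat \<Rightarrow> monom list \<Rightarrow> lp_vars \<Rightarrow> rpoly" where
  "gram_arg f g b a mx v =
     (let s1 = quad_poly mx (Q1 v); s2 = quad_poly mx (Q2 v);
          p10 = lin_poly mx (c10 v); p20 = lin_poly mx (c20 v);
          p1 = lin_poly_vec mx (c1 v); p2 = lin_poly_vec mx (c2 v)
      in (s1 + b * p10 + lie_g g b \<bullet> p1) * lie_f f b
           - s2 - b * p20 - lie_g g b \<bullet> p2 - lie_f f b ^ (2 * a))"

text \<open>
  The degree in \<open>x\<close> of the argument of the Gram operation as a polynomial whose coefficients are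
  functions of the decision variables, that is, the largest degree attained. Hence the size of the
  Gram matrix, and with it the number of linear constraints, does not vary with those variables.
\<close>

definition gram_arg_degree ::
  "rpoly vec \<Rightarrow> rpoly mat \<Rightarrow> rpoly \<Rightarrow> nat \<Rightarrow> monom list \<Rightarrow> nat" where
  "gram_arg_degree f g b a mx =
     (SUP v \<in> lp_vars_set (length mx) (dim_col g). total_degree (gram_arg f g b a mx v))"

definition lp_feasible ::
  "rpoly vec \<Rightarrow> rpoly mat \<Rightarrow> rpoly \<Rightarrow> nat \<Rightarrow> monom list \<Rightarrow> monom list \<Rightarrow> (rpoly \<Rightarrow> real mat)
     \<Rightarrow> real vec set" where
  "lp_feasible f g b a mx \<mu> G =
     (let k = length mx; m = dim_col g in
        {z \<in> carrier_vec (2 * k\<^sup>2 + (2 * m + 4) * k).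
           \<exists>v \<in> lp_vars_set k m. z = decision_vec v \<and>
             dd_constraints (Q1 v) (\<tau>1 v) \<and> dd_constraints (Q2 v) (\<tau>2 v) \<and>
             G (gram_arg f g b a mx v) = 0\<^sub>m (length \<mu>) (length \<mu>)})"

definition is_minimizer :: "('a \<Rightarrow> real) \<Rightarrow> 'a set \<Rightarrow> 'a \<Rightarrow> bool" where
  "is_minimizer obj S z \<longleftrightarrow> z \<in> S \<and> (\<forall>z'\<in>S. obj z \<le> obj z')"

definition lp_solution ::
  "rpoly vec \<Rightarrow> rpoly mat \<Rightarrow> rpoly \<Rightarrow> nat \<Rightarrow> monom list \<Rightarrow> monom list \<Rightarrow> (rpoly \<Rightarrow> real mat)
     \<Rightarrow> real vec \<Rightarrow> bool" where
  "lp_solution f g b a mx \<mu> G z \<longleftrightarrow> is_minimizer (\<lambda>_. 0) (lp_feasible f g b a mx \<mu> G) z"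

end

theory Submission
  imports Defs
begin

text \<open>
  A polynomial with vanishing Gram matrix is zero, so a feasible point of the program yields the
  identity \<open>(s\<^sub>1 + b p\<^sub>1\<^sub>0 + L\<^sub>g b p\<^sub>1) L\<^sub>f b = s\<^sub>2 + b p\<^sub>2\<^sub>0 + L\<^sub>g b p\<^sub>2 + (L\<^sub>f b)\<^sup>2\<^sup>a\<close>. At a point with
  \<open>b = 0\<close>, \<open>L\<^sub>g b = 0\<close> and \<open>L\<^sub>f b < 0\<close> it reduces to \<open>s\<^sub>1 L\<^sub>f b = s\<^sub>2 + (L\<^sub>f b)\<^sup>2\<^sup>a\<close>, whose left-hand side
  is nonpositive and whose right-hand side is positive, since DSOS polynomials are nonnegative.
  The Gram operation is only specified on polynomials of degree at most \<open>2l\<close>; that the argument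
  of the program is one of them needs its degree to be bounded uniformly in the decision
  variables, because the supremum of an unbounded set of naturals is unspecified.
\<close>

section \<open>Degrees\<close>

text \<open>Exponents outside the support are 0, so any finite superset may serve as index set. A
  product of two monomials needs such a common index set.\<close>

lemma monom_degree_superset:
  assumes "finite S" "Poly_Mapping.keys \<alpha> \<subseteq> S"
  shows "monom_degree \<alpha> = (\<Sum>i\<in>S. Poly_Mapping.lookup \<alpha> i)"
  unfolding monom_degree_def using assms
  by (intro sum.mono_neutral_left) (auto simp: in_keys_iff)

text \<open>Natural exponents cannot cancel, so the inclusion valid for general sums becomes an
  equality.\<close>

lemma keys_add_nat:
  fixes \<alpha> \<beta> :: monom
  shows "Poly_Mapping.keys (\<alpha> + \<beta>) = Poly_Mapping.keys \<alpha> \<union> Poly_Mapping.keys \<beta>"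
  by (auto simp: in_keys_iff lookup_add)

lemma monom_degree_add: "monom_degree (\<alpha> + \<beta>) = monom_degree \<alpha> + monom_degree \<beta>"
proof -
  let ?S = "Poly_Mapping.keys \<alpha> \<union> Poly_Mapping.keys \<beta>"
  have "monom_degree (\<alpha> + \<beta>) = (\<Sum>i\<in>?S. Poly_Mapping.lookup \<alpha> i + Poly_Mapping.lookup \<beta> i)"
    by (simp add: monom_degree_def keys_add_nat lookup_add)
  also have "\<dots> = monom_degree \<alpha> + monom_degree \<beta>"
    by (simp add: sum.distrib monom_degree_superset[of ?S \<alpha>] monom_degree_superset[of ?S \<beta>])
  finally show ?thesis .
qed

lemma total_degree_le_iff: "total_degree p \<le> d \<longleftrightarrow> (\<forall>\<alpha>\<in>Poly_Mapping.keys p. monom_degree \<alpha> \<le> d)"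
  by (auto simp: total_degree_def)

lemma total_degree_add_le: "total_degree p \<le> d \<Longrightarrow> total_degree q \<le> d \<Longrightarrow> total_degree (p + q) \<le> d"
  using keys_add[of p q] by (auto simp: total_degree_le_iff)

lemma total_degree_diff_le: "total_degree p \<le> d \<Longrightarrow> total_degree q \<le> d \<Longrightarrow> total_degree (p - q) \<le> d"
  using keys_diff[of p q] by (auto simp: total_degree_le_iff)

lemma total_degree_mult_le:
  assumes "total_degree p \<le> d" "total_degree q \<le> e"
  shows "total_degree (p * q) \<le> d + e"
  using assms keys_mult[of p q]
  by (fastforce simp: total_degree_le_iff monom_degree_add intro: add_mono)

lemma total_degree_single_le: "total_degree (Poly_Mapping.single \<alpha> c) \<le> monom_degree \<alpha>"
  by (simp add: total_degree_le_iff)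

lemma total_degree_const_poly [simp]: "total_degree (const_poly c) = 0"
  using total_degree_single_le[of 0 c] by (simp add: const_poly_def monom_degree_def)

lemma total_degree_power_le: "total_degree (p ^ k) \<le> k * total_degree p"
proof (induction k)
  case 0
  show ?case using total_degree_const_poly[of 1] by (simp add: const_poly_def)
next
  case (Suc k)
  then show ?case using total_degree_mult_le[of p "total_degree p" "p ^ k"] by simp
qed

lemma total_degree_sum_le:
  assumes "\<And>i. i \<in> I \<Longrightarrow> total_degree (p i) \<le> d"
  shows "total_degree (sum p I) \<le> d"
  using assms keys_sum[of p I] by (fastforce simp: total_degree_le_iff)

text \<open>\<open>scalar_prod\<close> sums over the indices of its second argument, hence the
  bounds in terms of \<open>dim_vec w\<close>.\<close>

lemma total_degree_scalar_prod_le: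
  assumes "\<And>i. i < dim_vec w \<Longrightarrow> total_degree (v $ i) \<le> d"
    and "\<And>i. i < dim_vec w \<Longrightarrow> total_degree (w $ i) \<le> e"
  shows "total_degree (v \<bullet> w) \<le> d + e"
  unfolding scalar_prod_def
  by (intro total_degree_sum_le total_degree_mult_le assms) auto

section \<open>Polynomials in the first \<open>n\<close> variables\<close>

lemma poly_ring_add: "p \<in> poly_ring n \<Longrightarrow> q \<in> poly_ring n \<Longrightarrow> p + q \<in> poly_ring n"
  using keys_add[of p q] by (auto simp: poly_ring_def)

lemma poly_ring_diff: "p \<in> poly_ring n \<Longrightarrow> q \<in> poly_ring n \<Longrightarrow> p - q \<in> poly_ring n"
  using keys_diff[of p q] by (auto simp: poly_ring_def)

lemma poly_ring_mult: "p \<in> poly_ring n \<Longrightarrow> q \<in> poly_ring n \<Longrightarrow> p * q \<in> poly_ring n"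
  using keys_mult[of p q] unfolding poly_ring_def by (force simp: keys_add_nat subset_iff)

lemma poly_ring_single:
  "Poly_Mapping.keys \<alpha> \<subseteq> {..<n} \<Longrightarrow> Poly_Mapping.single \<alpha> c \<in> poly_ring n"
  by (simp add: poly_ring_def)

lemma poly_ring_const_poly: "const_poly c \<in> poly_ring n"
  by (simp add: const_poly_def poly_ring_single)

lemma poly_ring_power: "p \<in> poly_ring n \<Longrightarrow> p ^ k \<in> poly_ring n"
proof (induction k)
  case 0
  show ?case using poly_ring_const_poly[of 1 n] by (simp add: const_poly_def)
qed (simp add: poly_ring_mult)

lemma poly_ring_sum: "(\<And>i. i \<in> I \<Longrightarrow> p i \<in> poly_ring n) \<Longrightarrow> sum p I \<in> poly_ring n"
  using keys_sum[of p I] unfolding poly_ring_def by blast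

lemma poly_ring_scalar_prod:
  assumes "\<And>i. i < dim_vec w \<Longrightarrow> v $ i \<in> poly_ring n" "\<And>i. i < dim_vec w \<Longrightarrow> w $ i \<in> poly_ring n"
  shows "v \<bullet> w \<in> poly_ring n"
  unfolding scalar_prod_def by (intro poly_ring_sum poly_ring_mult assms) auto

lemma poly_ring_partial_deriv:
  assumes "p \<in> poly_ring n"
  shows "partial_deriv i p \<in> poly_ring n"
  unfolding partial_deriv_def
proof (intro poly_ring_sum poly_ring_single)
  fix \<alpha> assume "\<alpha> \<in> Poly_Mapping.keys p"
  then have "Poly_Mapping.keys \<alpha> \<subseteq> {..<n}" using assms by (auto simp: poly_ring_def)
  \<comment> \<open>Truncated subtraction only lowers exponents, so differentiation introduces no
    new variable, whatever \<open>i\<close> is.\<close>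
  moreover have "Poly_Mapping.keys (\<alpha> - Poly_Mapping.single i 1) \<subseteq> Poly_Mapping.keys \<alpha>"
    by (auto simp: in_keys_iff lookup_minus)
  ultimately show "Poly_Mapping.keys (\<alpha> - Poly_Mapping.single i 1) \<subseteq> {..<n}" by simp
qed

lemma poly_ring_lie_f:
  assumes "f \<in> carrier_vec n" "\<forall>i < n. f $ i \<in> poly_ring n" "b \<in> poly_ring n"
  shows "lie_f f b \<in> poly_ring n"
  unfolding lie_f_def using assms
  by (intro poly_ring_scalar_prod) (auto simp: gradient_def poly_ring_partial_deriv)

lemma lie_g_carrier: "g \<in> carrier_mat n m \<Longrightarrow> lie_g g b \<in> carrier_vec m"
  by (intro carrier_vecI) (simp add: lie_g_def)

lemma poly_ring_lie_g:
  assumes "g \<in> carrier_mat n m" "\<forall>i < n. \<forall>j < m. g $$ (i, j) \<in> poly_ring n" "b \<in> poly_ring n" "j < m"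
  shows "lie_g g b $ j \<in> poly_ring n"
  using assms unfolding lie_g_def
  by (auto simp: gradient_def intro!: poly_ring_scalar_prod poly_ring_partial_deriv)

section \<open>Evaluation\<close>

text \<open>Names the inner product of \<open>eval_poly\<close>, so that multiplicativity can be
  settled on monomials first.\<close>

definition eval_monom :: "real vec \<Rightarrow> monom \<Rightarrow> real" where
  "eval_monom x \<alpha> = (\<Prod>i\<in>Poly_Mapping.keys \<alpha>. (x $ i) ^ Poly_Mapping.lookup \<alpha> i)"

lemma eval_monom_superset:
  assumes "finite S" "Poly_Mapping.keys \<alpha> \<subseteq> S"
  shows "eval_monom x \<alpha> = (\<Prod>i\<in>S. (x $ i) ^ Poly_Mapping.lookup \<alpha> i)"
  unfolding eval_monom_def using assms
  by (intro prod.mono_neutral_left) (auto simp: in_keys_iff)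

lemma eval_monom_add: "eval_monom x (\<alpha> + \<beta>) = eval_monom x \<alpha> * eval_monom x \<beta>"
proof -
  let ?S = "Poly_Mapping.keys \<alpha> \<union> Poly_Mapping.keys \<beta>"
  have "eval_monom x (\<alpha> + \<beta>) =
      (\<Prod>i\<in>?S. (x $ i) ^ Poly_Mapping.lookup \<alpha> i * (x $ i) ^ Poly_Mapping.lookup \<beta> i)"
    by (simp add: eval_monom_def keys_add_nat lookup_add power_add)
  also have "\<dots> = eval_monom x \<alpha> * eval_monom x \<beta>"
    by (simp add: prod.distrib eval_monom_superset[of ?S \<alpha>] eval_monom_superset[of ?S \<beta>])
  finally show ?thesis .
qed

lemma eval_poly_alt:
  "eval_poly x p = (\<Sum>\<alpha>\<in>Poly_Mapping.keys p. Poly_Mapping.lookup p \<alpha> * eval_monom x \<alpha>)"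
  by (simp add: eval_poly_def eval_monom_def)

lemma eval_poly_zero [simp]: "eval_poly x 0 = 0"
  by (simp add: eval_poly_alt)

lemma eval_poly_single: "eval_poly x (Poly_Mapping.single \<alpha> c) = c * eval_monom x \<alpha>"
  by (simp add: eval_poly_alt)

lemma eval_poly_const_poly [simp]: "eval_poly x (const_poly c) = c"
  by (simp add: const_poly_def eval_poly_single eval_monom_def)

lemma eval_poly_add: "eval_poly x (p + q) = eval_poly x p + eval_poly x q"
  unfolding eval_poly_alt
  \<comment> \<open>Cancellation may shrink the support of \<open>p + q\<close>; the rule copes with
    this because the summand is additive in the coefficient and vanishes at coefficient 0.\<close>
  by (rule setsum_keys_plus_distrib) (simp_all add: distrib_right)

lemma eval_poly_sum: "eval_poly x (sum p I) = (\<Sum>i\<in>I. eval_poly x (p i))"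
  by (induction I rule: infinite_finite_induct) (simp_all add: eval_poly_add)

lemma poly_eq_sum_single:
  fixes p :: rpoly
  shows "p = (\<Sum>\<alpha>\<in>Poly_Mapping.keys p. Poly_Mapping.single \<alpha> (Poly_Mapping.lookup p \<alpha>))"
  by (rule poly_mapping_eqI)
    (auto simp: lookup_sum lookup_single when_def in_keys_iff sum.delta)

text \<open>Both factors are expanded into their terms; by bilinearity the claim comes down to
  \<open>eval_monom_add\<close>.\<close>

lemma eval_poly_mult: "eval_poly x (p * q) = eval_poly x p * eval_poly x q"
proof -
  have "p * q = (\<Sum>\<alpha>\<in>Poly_Mapping.keys p. \<Sum>\<beta>\<in>Poly_Mapping.keys q.
      Poly_Mapping.single (\<alpha> + \<beta>) (Poly_Mapping.lookup p \<alpha> * Poly_Mapping.lookup q \<beta>))"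
    by (subst poly_eq_sum_single[of p], subst poly_eq_sum_single[of q])
      (simp add: sum_product mult_single)
  then show ?thesis
    by (simp add: eval_poly_sum eval_poly_single eval_monom_add)
      (simp add: eval_poly_alt sum_product mult_ac)
qed

text \<open>Makes the homomorphism rules for powers, differences and matrix-vector products
  available for evaluation at a point.\<close>

interpretation eval_poly: comm_ring_hom "eval_poly x"
  by unfold_locales
    (simp_all add: eval_poly_add eval_poly_mult eval_poly_single eval_monom_def
      flip: single_one)

text \<open>Equal dimensions keep every summation index in range for \<open>v\<close> too, where the
  entries of the mapped vector are specified.\<close>

lemma (in semiring_hom) scalar_prod_hom:
  assumes "dim_vec v = dim_vec w"
  shows "hom (v \<bullet> w) = vec\<^sub>h v \<bullet> vec\<^sub>h w"
  using assms by (simp add: scalar_prod_def hom_sum hom_mult)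

section \<open>Linear and quadratic forms in the monomial basis\<close>

lemma monom_vec_carrier: "monom_vec \<mu> \<in> carrier_vec (length \<mu>)"
  by (intro carrier_vecI) (simp add: monom_vec_def)

lemma monom_vec_index: "i < length \<mu> \<Longrightarrow> monom_vec \<mu> $ i = Poly_Mapping.single (\<mu> ! i) 1"
  by (simp add: monom_vec_def vec_of_list_index)

lemma monom_vec_entry:
  assumes "monomial_basis n \<delta> \<mu>" "i < length \<mu>"
  shows "monom_vec \<mu> $ i \<in> poly_ring n" "total_degree (monom_vec \<mu> $ i) \<le> \<delta>"
proof -
  have *: "Poly_Mapping.keys (\<mu> ! i) \<subseteq> {..<n}" "monom_degree (\<mu> ! i) \<le> \<delta>"
    using assms nth_mem[of i \<mu>] unfolding monomial_basis_def by auto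
  show "monom_vec \<mu> $ i \<in> poly_ring n"
    using * assms(2) by (simp add: monom_vec_index poly_ring_single)
  show "total_degree (monom_vec \<mu> $ i) \<le> \<delta>"
    using *(2) assms(2) total_degree_single_le[of "\<mu> ! i" 1] by (simp add: monom_vec_index)
qed

lemma const_scalar_prod_monom_vec:
  assumes "monomial_basis n \<delta> \<mu>" "dim_vec v = length \<mu>"
  shows "map_vec const_poly v \<bullet> monom_vec \<mu> \<in> poly_ring n"
    and "total_degree (map_vec const_poly v \<bullet> monom_vec \<mu>) \<le> \<delta>"
proof -
  show "map_vec const_poly v \<bullet> monom_vec \<mu> \<in> poly_ring n"
    using assms monom_vec_carrier[of \<mu>]
    by (intro poly_ring_scalar_prod) (auto simp: poly_ring_const_poly monom_vec_entry)
  show "total_degree (map_vec const_poly v \<bullet> monom_vec \<mu>) \<le> \<delta>"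
    using assms monom_vec_carrier[of \<mu>] total_degree_scalar_prod_le[of "monom_vec \<mu>" "map_vec const_poly v" 0 \<delta>]
    by (auto simp: monom_vec_entry)
qed

lemma const_mat_mult_monom_vec:
  assumes "monomial_basis n \<delta> \<mu>" "A \<in> carrier_mat r (length \<mu>)" "j < r"
  shows "(map_mat const_poly A *\<^sub>v monom_vec \<mu>) $ j \<in> poly_ring n"
    and "total_degree ((map_mat const_poly A *\<^sub>v monom_vec \<mu>) $ j) \<le> \<delta>"
proof -
  \<comment> \<open>Each entry is a linear form in the monomials with coefficients from one row of
    \<open>A\<close>.\<close>
  have "(map_mat const_poly A *\<^sub>v monom_vec \<mu>) $ j = map_vec const_poly (row A j) \<bullet> monom_vec \<mu>"
    using assms monom_vec_carrier[of \<mu>] by (simp add: scalar_prod_def)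
  then show "(map_mat const_poly A *\<^sub>v monom_vec \<mu>) $ j \<in> poly_ring n"
    and "total_degree ((map_mat const_poly A *\<^sub>v monom_vec \<mu>) $ j) \<le> \<delta>"
    using const_scalar_prod_monom_vec[OF assms(1), of "row A j"] assms(2) by auto
qed

lemma lin_poly_bounds:
  assumes "monomial_basis n \<delta> \<mu>" "c \<in> carrier_vec (length \<mu>)"
  shows "lin_poly \<mu> c \<in> poly_ring n" "total_degree (lin_poly \<mu> c) \<le> \<delta>"
  using const_scalar_prod_monom_vec[OF assms(1)] assms(2) by (auto simp: lin_poly_def)

lemma lin_poly_vec_carrier: "C \<in> carrier_mat k m \<Longrightarrow> lin_poly_vec \<mu> C \<in> carrier_vec m"
  by (intro carrier_vecI) (simp add: lin_poly_vec_def)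

lemma lin_poly_vec_bounds:
  assumes "monomial_basis n \<delta> \<mu>" "C \<in> carrier_mat (length \<mu>) m" "j < m"
  shows "lin_poly_vec \<mu> C $ j \<in> poly_ring n" "total_degree (lin_poly_vec \<mu> C $ j) \<le> \<delta>"
  using const_mat_mult_monom_vec[OF assms(1), of "transpose_mat C"] assms
  by (auto simp: lin_poly_vec_def)

lemma quad_poly_bounds:
  assumes "monomial_basis n \<delta> \<mu>" "Q \<in> carrier_mat (length \<mu>) (length \<mu>)"
  shows "quad_poly \<mu> Q \<in> poly_ring n" "total_degree (quad_poly \<mu> Q) \<le> \<delta> + \<delta>"
  \<comment> \<open>Without \<open>index_mult_mat_vec\<close>, entries of the matrix-vector product
    keep the shape that \<open>const_mat_mult_monom_vec\<close> matches.\<close>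
  unfolding quad_poly_def using assms monom_vec_carrier[of \<mu>]
  by (intro poly_ring_scalar_prod total_degree_scalar_prod_le;
      auto intro: monom_vec_entry const_mat_mult_monom_vec simp del: index_mult_mat_vec)+

text \<open>Combined with the representation in \<open>gram_operation\<close>, this turns the matrix
  equation of the program into a polynomial identity.\<close>

lemma quad_poly_zero: "quad_poly \<mu> (0\<^sub>m (length \<mu>) (length \<mu>)) = 0"
proof -
  have "map_mat const_poly (0\<^sub>m (length \<mu>) (length \<mu>)) = 0\<^sub>m (length \<mu>) (length \<mu>)"
    by (intro eq_matI) (simp_all add: const_poly_def)
  moreover have "0\<^sub>m (length \<mu>) (length \<mu>) *\<^sub>v monom_vec \<mu> = 0\<^sub>v (length \<mu>)"
    using monom_vec_carrier[of \<mu>] by (intro eq_vecI) simp_all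
  ultimately show ?thesis
    using monom_vec_carrier[of \<mu>] by (simp add: quad_poly_def)
qed

text \<open>Evaluation undoes the embedding of constants, leaving a real quadratic form at the
  vector of monomial values.\<close>

lemma eval_quad_poly:
  assumes "Q \<in> carrier_mat (length \<mu>) (length \<mu>)"
  shows "eval_poly x (quad_poly \<mu> Q) =
    map_vec (eval_poly x) (monom_vec \<mu>) \<bullet> (Q *\<^sub>v map_vec (eval_poly x) (monom_vec \<mu>))"
proof -
  have "map_mat (eval_poly x) (map_mat const_poly Q) = Q"
    by (intro eq_matI) simp_all
  then show ?thesis
    using assms monom_vec_carrier[of \<mu>] unfolding quad_poly_def
    by (subst eval_poly.scalar_prod_hom)
      (auto simp: eval_poly.mult_mat_vec_hom[of _ "length \<mu>" "length \<mu>"])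
qed

text \<open>By the arithmetic-geometric mean inequality each off-diagonal term is at least
  \<open>-\<bar>Q $$ (i, j)\<bar> * ((v $ i)\<^sup>2 + (v $ j)\<^sup>2) / 2\<close>. Symmetry
  collects these losses row by row, so the form dominates the sum of the squares
  \<open>(v $ i)\<^sup>2\<close> weighted by the dominance gap of row \<open>i\<close>.\<close>

lemma dd_psd_quadratic_form_nonneg:
  assumes Q: "Q \<in> sym_mats k" and dd: "dd_psd Q" and v: "v \<in> carrier_vec k"
  shows "0 \<le> v \<bullet> (Q *\<^sub>v v)"
proof -
  have dim: "dim_row Q = k" "dim_col Q = k" "dim_vec v = k"
    using Q v by (auto simp: sym_mats_def)
  have sym: "Q $$ (i, j) = Q $$ (j, i)" if "i < k" "j < k" for i j
    using Q that dim index_transpose_mat(1)[of i Q j] by (auto simp: sym_mats_def)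
  let ?off = "\<lambda>h. \<Sum>i<k. \<Sum>j\<in>{..<k} - {i}. h i j :: real"
  have swap: "?off h = ?off (\<lambda>i j. h j i)" for h
  proof -
    \<comment> \<open>Both set differences are written through the symmetric relation of being
      distinct, so that the restricted exchange of sums applies.\<close>
    have "{..<k} - {i} = {j \<in> {..<k}. j \<noteq> i}" "{..<k} - {i} = {j \<in> {..<k}. i \<noteq> j}" for i
      by auto
    then show ?thesis
      using sum.swap_restrict[of "{..<k}" "{..<k}" h "\<lambda>i j. i \<noteq> j"] by simp
  qed
  have "v \<bullet> (Q *\<^sub>v v) = (\<Sum>i<k. \<Sum>j<k. v $ i * Q $$ (i, j) * v $ j)"
    using dim by (simp add: scalar_prod_def sum_distrib_left atLeast0LessThan mult.assoc)
  also have "\<dots> = (\<Sum>i<k. Q $$ (i, i) * (v $ i)\<^sup>2) + ?off (\<lambda>i j. v $ i * Q $$ (i, j) * v $ j)"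
    by (simp add: sum.remove[of "{..<k}"] sum.distrib power2_eq_square mult_ac)
  also have "\<dots> \<ge> (\<Sum>i<k. Q $$ (i, i) * (v $ i)\<^sup>2)
      + ?off (\<lambda>i j. - (\<bar>Q $$ (i, j)\<bar> * (v $ i)\<^sup>2 / 2 + \<bar>Q $$ (i, j)\<bar> * (v $ j)\<^sup>2 / 2))"
  proof (intro add_left_mono sum_mono)
    fix i j
    have "2 * (\<bar>v $ i\<bar> * \<bar>v $ j\<bar>) \<le> (v $ i)\<^sup>2 + (v $ j)\<^sup>2"
      using sum_squares_bound[of "\<bar>v $ i\<bar>" "\<bar>v $ j\<bar>"] by simp
    then have "\<bar>Q $$ (i, j)\<bar> * (2 * (\<bar>v $ i\<bar> * \<bar>v $ j\<bar>)) \<le> \<bar>Q $$ (i, j)\<bar> * ((v $ i)\<^sup>2 + (v $ j)\<^sup>2)"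
      by (intro mult_left_mono) auto
    moreover have "\<bar>v $ i * Q $$ (i, j) * v $ j\<bar> = \<bar>Q $$ (i, j)\<bar> * (\<bar>v $ i\<bar> * \<bar>v $ j\<bar>)"
      by (simp add: abs_mult)
    moreover have "- \<bar>v $ i * Q $$ (i, j) * v $ j\<bar> \<le> v $ i * Q $$ (i, j) * v $ j"
      by linarith
    ultimately show "- (\<bar>Q $$ (i, j)\<bar> * (v $ i)\<^sup>2 / 2 + \<bar>Q $$ (i, j)\<bar> * (v $ j)\<^sup>2 / 2)
        \<le> v $ i * Q $$ (i, j) * v $ j"
      unfolding distrib_left by linarith
  qed
  also have "?off (\<lambda>i j. - (\<bar>Q $$ (i, j)\<bar> * (v $ i)\<^sup>2 / 2 + \<bar>Q $$ (i, j)\<bar> * (v $ j)\<^sup>2 / 2))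
      = - ?off (\<lambda>i j. \<bar>Q $$ (i, j)\<bar> * (v $ i)\<^sup>2)"
  proof -
    \<comment> \<open>Exchanging the indices and using symmetry of \<open>Q\<close> makes the two
      halves equal; together they charge row \<open>i\<close> with its full off-diagonal
      sum.\<close>
    have "?off (\<lambda>i j. \<bar>Q $$ (i, j)\<bar> * (v $ j)\<^sup>2 / 2) = ?off (\<lambda>i j. \<bar>Q $$ (i, j)\<bar> * (v $ i)\<^sup>2 / 2)"
      by (subst swap) (auto intro!: sum.cong simp: sym)
    then show ?thesis
      by (simp add: sum.distrib sum_negf sum_subtractf flip: sum_divide_distrib)
  qed
  also have "(\<Sum>i<k. Q $$ (i, i) * (v $ i)\<^sup>2) + - ?off (\<lambda>i j. \<bar>Q $$ (i, j)\<bar> * (v $ i)\<^sup>2)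
      = (\<Sum>i<k. (Q $$ (i, i) - (\<Sum>j\<in>{..<k} - {i}. \<bar>Q $$ (i, j)\<bar>)) * (v $ i)\<^sup>2)"
    by (simp add: sum_subtractf left_diff_distrib sum_distrib_right)
  finally have "(\<Sum>i<k. (Q $$ (i, i) - (\<Sum>j\<in>{..<k} - {i}. \<bar>Q $$ (i, j)\<bar>)) * (v $ i)\<^sup>2)
      \<le> v \<bullet> (Q *\<^sub>v v)" .
  moreover have "0 \<le> (\<Sum>i<k. (Q $$ (i, i) - (\<Sum>j\<in>{..<k} - {i}. \<bar>Q $$ (i, j)\<bar>)) * (v $ i)\<^sup>2)"
    using dd dim by (intro sum_nonneg mult_nonneg_nonneg) (auto simp: dd_psd_def)
  ultimately show ?thesis by linarith
qed

text \<open>The auxiliary matrix \<open>\<tau>\<close> certifies diagonal dominance of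
  \<open>Q\<close>, and the evaluated polynomial is the quadratic form of \<open>Q\<close>.\<close>

lemma eval_dsos_nonneg:
  assumes "Q \<in> sym_mats (length \<mu>)" "\<tau> \<in> sym_mats (length \<mu>)" "dd_constraints Q \<tau>"
  shows "0 \<le> eval_poly x (quad_poly \<mu> Q)"
proof -
  have "dd_psd Q" using assms dd_psd_iff_dd_constraints by blast
  then show ?thesis
    using assms(1) dd_psd_quadratic_form_nonneg[OF assms(1)] monom_vec_carrier[of \<mu>]
    by (auto simp: eval_quad_poly sym_mats_def)
qed

section \<open>The argument of the Gram operation\<close>

text \<open>First half of membership in the domain on which \<open>gram_operation\<close> specifies
  \<open>G\<close>; the degree bound is the other half.\<close>

lemma gram_arg_poly_ring:
  assumes f: "f \<in> carrier_vec n" "\<forall>i < n. f $ i \<in> poly_ring n"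
    and g: "g \<in> carrier_mat n m" "\<forall>i < n. \<forall>j < m. g $$ (i, j) \<in> poly_ring n"
    and b: "b \<in> poly_ring n"
    and mx: "monomial_basis n \<delta> mx"
    and v: "v \<in> lp_vars_set (length mx) m"
  shows "gram_arg f g b a mx v \<in> poly_ring n"
proof -
  have dims: "c10 v \<in> carrier_vec (length mx)" "c20 v \<in> carrier_vec (length mx)"
    "c1 v \<in> carrier_mat (length mx) m" "c2 v \<in> carrier_mat (length mx) m"
    "Q1 v \<in> carrier_mat (length mx) (length mx)" "Q2 v \<in> carrier_mat (length mx) (length mx)"
    using v by (auto simp: lp_vars_set_def sym_mats_def)
  have lg: "lie_g g b \<bullet> lin_poly_vec mx C \<in> poly_ring n" if C: "C \<in> carrier_mat (length mx) m" for C
    using lin_poly_vec_carrier[OF C, of mx]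
    by (intro poly_ring_scalar_prod) (auto intro: poly_ring_lie_g[OF g b] lin_poly_vec_bounds(1)[OF mx C])
  show ?thesis
    unfolding gram_arg_def Let_def using dims
    by (intro poly_ring_diff poly_ring_add poly_ring_mult poly_ring_power poly_ring_lie_f[OF f b] b lg
        lin_poly_bounds(1)[OF mx] quad_poly_bounds(1)[OF mx])
qed

text \<open>The decision variables enter only as coefficients of products of at most two basis
  monomials, each of degree at most \<delta>.\<close>

lemma total_degree_gram_arg_bounded:
  assumes g: "g \<in> carrier_mat n m" and mx: "monomial_basis n \<delta> mx"
  obtains D where "\<And>v. v \<in> lp_vars_set (length mx) m \<Longrightarrow> total_degree (gram_arg f g b a mx v) \<le> D"
proof
  fix v assume v: "v \<in> lp_vars_set (length mx) m"
  have dims: "c10 v \<in> carrier_vec (length mx)" "c20 v \<in> carrier_vec (length mx)"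
    "c1 v \<in> carrier_mat (length mx) m" "c2 v \<in> carrier_mat (length mx) m"
    "Q1 v \<in> carrier_mat (length mx) (length mx)" "Q2 v \<in> carrier_mat (length mx) (length mx)"
    using v by (auto simp: lp_vars_set_def sym_mats_def)
  \<comment> \<open>Sums stand in for maxima: each single degree is bounded by dropping nonnegative
    summands. The resulting \<open>?D\<close> is free of \<open>v\<close>, as a uniform bound must
    be.\<close>
  let ?dg = "\<Sum>j<m. total_degree (lie_g g b $ j)"
  let ?A = "\<delta> + \<delta> + (total_degree b + \<delta>) + (?dg + \<delta>)"
  let ?dL = "total_degree (lie_f f b)"
  let ?D = "?A + ?dL + 2 * a * ?dL"
  have s: "total_degree (quad_poly mx Q) \<le> ?A" if "Q \<in> carrier_mat (length mx) (length mx)" for Q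
    using quad_poly_bounds(2)[OF mx that] by simp
  have bp: "total_degree (b * lin_poly mx c) \<le> ?A" if "c \<in> carrier_vec (length mx)" for c
    using total_degree_mult_le[OF order_refl lin_poly_bounds(2)[OF mx that], of b] by simp
  have lg: "total_degree (lie_g g b \<bullet> lin_poly_vec mx C) \<le> ?A" if C: "C \<in> carrier_mat (length mx) m" for C
  proof -
    have "total_degree (lie_g g b $ j) \<le> ?dg" if "j < m" for j
      using that by (intro member_le_sum) auto
    then have "total_degree (lie_g g b \<bullet> lin_poly_vec mx C) \<le> ?dg + \<delta>"
      using lin_poly_vec_carrier[OF C, of mx] lin_poly_vec_bounds(2)[OF mx C]
      by (intro total_degree_scalar_prod_le) auto
    then show ?thesis by simp
  qed
  have up: "total_degree p \<le> ?D" if "total_degree p \<le> ?A" for p :: rpoly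
    using that by simp
  have "total_degree ((quad_poly mx (Q1 v) + b * lin_poly mx (c10 v) + lie_g g b \<bullet> lin_poly_vec mx (c1 v))
      * lie_f f b) \<le> ?A + ?dL"
    using dims by (intro total_degree_mult_le total_degree_add_le s bp lg order_refl)
  moreover have "total_degree (lie_f f b ^ (2 * a)) \<le> 2 * a * ?dL"
    by (rule total_degree_power_le)
  ultimately show "total_degree (gram_arg f g b a mx v) \<le> ?D"
    unfolding gram_arg_def Let_def using dims
    by (intro total_degree_diff_le up[OF s] up[OF bp] up[OF lg]) auto
qed

lemma total_degree_gram_arg_le:
  assumes "g \<in> carrier_mat n m" "monomial_basis n \<delta> mx" "v \<in> lp_vars_set (length mx) m"
  shows "total_degree (gram_arg f g b a mx v) \<le> gram_arg_degree f g b a mx"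
proof -
  obtain D where "\<And>w. w \<in> lp_vars_set (length mx) m \<Longrightarrow> total_degree (gram_arg f g b a mx w) \<le> D"
    using total_degree_gram_arg_bounded[OF assms(1,2), of f b a] by blast
  \<comment> \<open>On the naturals a supremum is an upper bound only for sets that are bounded
    above.\<close>
  then have "bdd_above ((\<lambda>w. total_degree (gram_arg f g b a mx w)) ` lp_vars_set (length mx) m)"
    by (rule bdd_aboveI2)
  then show ?thesis
    using assms(1,3) by (auto simp: gram_arg_degree_def intro: cSUP_upper)
qed

text \<open>Where \<open>b\<close> and \<open>lie_g g b\<close> vanish, the multipliers of arbitrary
  sign drop out and only the DSOS terms and the even power survive.\<close>

lemma eval_gram_arg:
  assumes g: "g \<in> carrier_mat n m" and v: "v \<in> lp_vars_set (length mx) m"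
    and b: "eval_poly x b = 0" and lg: "map_vec (eval_poly x) (lie_g g b) = 0\<^sub>v m"
  shows "eval_poly x (gram_arg f g b a mx v) =
    eval_poly x (quad_poly mx (Q1 v)) * eval_poly x (lie_f f b)
      - eval_poly x (quad_poly mx (Q2 v)) - eval_poly x (lie_f f b) ^ (2 * a)"
proof -
  have "eval_poly x (lie_g g b \<bullet> lin_poly_vec mx C) = 0" if C: "C \<in> carrier_mat (length mx) m" for C
  proof -
    have "eval_poly x (lie_g g b \<bullet> lin_poly_vec mx C) = 0\<^sub>v m \<bullet> map_vec (eval_poly x) (lin_poly_vec mx C)"
      using lie_g_carrier[OF g, of b] lin_poly_vec_carrier[OF C, of mx]
      by (subst eval_poly.scalar_prod_hom) (auto simp: lg)
    then show ?thesis using lin_poly_vec_carrier[OF C, of mx] by simp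
  qed
  then show ?thesis
    using v b by (simp add: gram_arg_def Let_def lp_vars_set_def eval_poly.hom_add eval_poly.hom_mult
        eval_poly.hom_minus eval_poly.hom_power)
qed

text \<open>The criterion is proved outright; \<open>cbf\<close> follows from it under the adopted
  characterization, assumed only for the given \<open>f\<close>, \<open>g\<close> and
  \<open>b\<close>.\<close>

theorem theorem3:
  fixes n m a \<delta> l :: nat
    and f :: "rpoly vec" and g :: "rpoly mat" and b :: rpoly
    and mx \<mu> :: "monom list" and G :: "rpoly \<Rightarrow> real mat"
  assumes f: "f \<in> carrier_vec n" "\<forall>i < n. f $ i \<in> poly_ring n"
    and g: "g \<in> carrier_mat n m" "\<forall>i < n. \<forall>j < m. g $$ (i, j) \<in> poly_ring n"
    and b: "b \<in> poly_ring n"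
    and mx: "monomial_basis n \<delta> mx"
    and l: "l = nat \<lceil>real (gram_arg_degree f g b a mx) / 2\<rceil>"
    and \<mu>: "monomial_basis n l \<mu>"
    and G: "gram_operation n l \<mu> G"
    and solution: "\<exists>z. lp_solution f g b a mx \<mu> G z"
  shows "cbf_criterion f g b \<and> ((cbf f g b \<longleftrightarrow> cbf_criterion f g b) \<longrightarrow> cbf f g b)"
proof -
  \<comment> \<open>The objective is constant, so a minimizer amounts to a feasible point.\<close>
  obtain v where v: "v \<in> lp_vars_set (length mx) m"
    and dd: "dd_constraints (Q1 v) (\<tau>1 v)" "dd_constraints (Q2 v) (\<tau>2 v)"
    and Gv: "G (gram_arg f g b a mx v) = 0\<^sub>m (length \<mu>) (length \<mu>)"
    using solution g(1) unfolding lp_solution_def is_minimizer_def lp_feasible_def Let_def by auto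
  \<comment> \<open>Rounding up covers odd degrees.\<close>
  have "gram_arg_degree f g b a mx \<le> 2 * l"
    unfolding l by linarith
  then have "total_degree (gram_arg f g b a mx v) \<le> 2 * l"
    using total_degree_gram_arg_le[OF g(1) mx v] order_trans by blast
  then have "gram_arg f g b a mx v = quad_poly \<mu> (G (gram_arg f g b a mx v))"
    using G gram_arg_poly_ring[OF f g b mx v] unfolding gram_operation_def Let_def by blast
  then have zero: "gram_arg f g b a mx v = 0"
    by (simp add: Gv quad_poly_zero)
  have "cbf_criterion f g b"
    unfolding cbf_criterion_def
  proof
    assume "\<exists>x\<in>carrier_vec (dim_vec f). eval_poly x b = 0 \<and>
      map_vec (eval_poly x) (lie_g g b) = 0\<^sub>v (dim_col g) \<and> eval_poly x (lie_f f b) < 0"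
    then obtain x where x: "eval_poly x b = 0" "map_vec (eval_poly x) (lie_g g b) = 0\<^sub>v m"
      and neg: "eval_poly x (lie_f f b) < 0"
      using g(1) by auto
    have "eval_poly x (quad_poly mx (Q1 v)) * eval_poly x (lie_f f b) =
        eval_poly x (quad_poly mx (Q2 v)) + eval_poly x (lie_f f b) ^ (2 * a)"
      using eval_gram_arg[OF g(1) v x, of f a] by (simp add: zero)
    moreover have "0 \<le> eval_poly x (quad_poly mx (Q1 v))" "0 \<le> eval_poly x (quad_poly mx (Q2 v))"
      using v dd by (auto simp: lp_vars_set_def intro: eval_dsos_nonneg)
    \<comment> \<open>An even power of a nonzero number is positive; for \<open>a = 0\<close> it
      equals 1.\<close>
    moreover have "0 < eval_poly x (lie_f f b) ^ (2 * a)"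
      using neg by (simp add: zero_less_power_eq)
    ultimately show False
      using neg mult_nonneg_nonpos[of "eval_poly x (quad_poly mx (Q1 v))" "eval_poly x (lie_f f b)"]
      by linarith
  qed
  then show ?thesis by blast
qed

end
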